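(* Suppose Assumption A holds. Then for every $\epsilon>0$ and $r>0$ with $\overline{\mathrm{conv}(S)}\cap\mathbf{B}_r\neq\emptyset$, there exists an integer $k_{r,\epsilon}$ such that $$\overline{\mathrm{conv}(S)}\cap\mathbf{B}_r\subseteq\widetilde{\mathrm{TH}}_{k_{r,\epsilon}}(\tilde G)\cap\mathbf{B}_r\subseteq\big(\overline{\mathrm{conv}(S)}+\epsilon\mathbf{B}_1\big)\cap\mathbf{B}_r.$$
   Context: $\mathbf{B}_r=\{x\in\mathbb{R}^n:\|x\|_2\le r\}$. $X=(X_1,\dots,X_n)$, $\tilde X=(X_0,X_1,\dots,X_n)$, $\|\cdot\|_2$ Euclidean norm. For $f\in\mathbb{R}[X]$ of degree $d$, its homogenization is $\tilde f(\tilde X)=X_0^df(X/X_0)\in\mathbb{R}[\tilde X]$. Fix $g_1,\dots,g_m\in\mathbb{R}[X]$ and $S=\{x\in\mathbb{R}^n:g_1(x)\ge0,\dots,g_m(x)\ge0\}$. Define $\tilde S^{o}=\{\tilde x=(x_0,x)\in\mathbb{R}^{n+1}:\tilde g_j(\tilde x)\ge0\ (j=1,\dots,m),\ x_0>0\}$, $\tilde S^{c}$ the same set with $x_0\ge0$ in place of $x_0>0$, and $\tilde S=\tilde S^c\cap\{\|\tilde x\|_2=1\}$. $S$ is closed at $\infty$ if $\overline{\tilde S^{o}}=\tilde S^{c}$. For a finite set $H=\{h_1,\dots,h_r\}$ of polynomials, the $k$-th quadratic module is $\mathcal{Q}_k(H)=\{\sum_{j=0}^r\sigma_jh_j:h_0=1,\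 \sigma_j\text{ sums of squares of polynomials},\ \deg(\sigma_jh_j)\le2k\}$. Let $\tilde G=\{\tilde g_1,\dots,\tilde g_m,X_0,\|\tilde X\|_2^2-1,1-\|\tilde X\|_2^2\}$. Let $\mathcal{P}[\tilde X]_1$ be the set of linear forms (homogeneous of degree one) in $\tilde X$ together with $0$. The modified theta body is $\widetilde{\mathrm{TH}}_k(\tilde G)=\{x\in\mathbb{R}^n:\tilde l(1,x)\ge0\ \forall\tilde l\in\mathcal{Q}_k(\tilde G)\cap\mathcal{P}[\tilde X]_1\}$. A closed convex cone $K$ is pointed if $K\cap(-K)=\{0\}$. Assumption A: (i) $S$ is closed at $\infty$; (ii) the convex cone $\mathrm{conv}(\overline{\tilde S^{o}})$ is closed and pointed. *)

theory Defs
  imports "HOL-Analysis.Analysis" "HOL-Library.Poly_Mapping"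
begin

type_synonym 'v mpoly = "('v \<Rightarrow>\<^sub>0 nat) \<Rightarrow>\<^sub>0 real"

definition mono_deg :: "('v \<Rightarrow>\<^sub>0 nat) \<Rightarrow> nat" where
  "mono_deg m = (\<Sum>i\<in>Poly_Mapping.keys m. Poly_Mapping.lookup m i)"

definition total_deg :: "'v mpoly \<Rightarrow> nat" where
  "total_deg p = Max (insert 0 (mono_deg ` Poly_Mapping.keys p))"

definition peval :: "'v mpoly \<Rightarrow> ('v \<Rightarrow> real) \<Rightarrow> real" where
  "peval p v = (\<Sum>m\<in>Poly_Mapping.keys p. Poly_Mapping.lookup p m * (\<Prod>i\<in>Poly_Mapping.keys m. v i ^ Poly_Mapping.lookup m i))"

definition pvar :: "'v \<Rightarrow> 'v mpoly" where
  "pvar i = Poly_Mapping.single (Poly_Mapping.single i 1) 1"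

text \<open>Homogenization: variable None is X_0, Some i is X_i.
  hom f = X_0^d f(X/X_0) with d = total degree of f.\<close>
definition hom_mono :: "nat \<Rightarrow> ('v \<Rightarrow>\<^sub>0 nat) \<Rightarrow> ('v option \<Rightarrow>\<^sub>0 nat)" where
  "hom_mono d m = Poly_Mapping.single None (d - mono_deg m)
     + (\<Sum>i\<in>Poly_Mapping.keys m. Poly_Mapping.single (Some i) (Poly_Mapping.lookup m i))"

definition homogenize :: "'v mpoly \<Rightarrow> 'v option mpoly" where
  "homogenize f = (\<Sum>m\<in>Poly_Mapping.keys f. Poly_Mapping.single (hom_mono (total_deg f) m) (Poly_Mapping.lookup f m))"

definition is_sos :: "'v mpoly \<Rightarrow> bool" where
  "is_sos s \<longleftrightarrow> (\<exists>qs. s = sum_list (map (\<lambda>q. q * q) qs))"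

definition quad_module :: "nat \<Rightarrow> 'v mpoly list \<Rightarrow> 'v mpoly set" where
  "quad_module k H = {p. \<exists>\<sigma> :: nat \<Rightarrow> 'v mpoly.
      (\<forall>j\<le>length H. is_sos (\<sigma> j) \<and>
          total_deg (\<sigma> j * (if j = 0 then 1 else H ! (j - 1))) \<le> 2 * k) \<and>
      p = (\<Sum>j\<le>length H. \<sigma> j * (if j = 0 then 1 else H ! (j - 1)))}"

definition linear_form :: "'v mpoly \<Rightarrow> bool" where
  "linear_form p \<longleftrightarrow> (\<forall>m\<in>Poly_Mapping.keys p. mono_deg m = 1)"

definition semialg :: "'n mpoly list \<Rightarrow> (real ^ 'n::finite) set" where
  "semialg gs = {x. \<forall>g\<in>set gs. peval g (\<lambda>i. x $ i) \<ge> 0}"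

definition S_open_tilde :: "'n mpoly list \<Rightarrow> (real ^ ('n::finite) option) set" where
  "S_open_tilde gs = {y. (\<forall>g\<in>set gs. peval (homogenize g) (\<lambda>i. y $ i) \<ge> 0) \<and> y $ None > 0}"

definition S_closed_tilde :: "'n mpoly list \<Rightarrow> (real ^ ('n::finite) option) set" where
  "S_closed_tilde gs = {y. (\<forall>g\<in>set gs. peval (homogenize g) (\<lambda>i. y $ i) \<ge> 0) \<and> y $ None \<ge> 0}"

definition closed_at_infinity :: "('n::finite) mpoly list \<Rightarrow> bool" where
  "closed_at_infinity gs \<longleftrightarrow> closure (S_open_tilde gs) = S_closed_tilde gs"

definition pointed :: "('a::real_vector) set \<Rightarrow> bool" where
  "pointed K \<longleftrightarrow> K \<inter> uminus ` K = {0}"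

definition assumption_A :: "('n::finite) mpoly list \<Rightarrow> bool" where
  "assumption_A gs \<longleftrightarrow> closed_at_infinity gs \<and>
     closed (convex hull (closure (S_open_tilde gs))) \<and>
     pointed (convex hull (closure (S_open_tilde gs)))"

definition norm_sq_poly :: "('n::finite) option mpoly" where
  "norm_sq_poly = (\<Sum>i\<in>UNIV. pvar i * pvar i)"

definition G_tilde :: "('n::finite) mpoly list \<Rightarrow> 'n option mpoly list" where
  "G_tilde gs = map homogenize gs @ [pvar None, norm_sq_poly - 1, 1 - norm_sq_poly]"

definition modified_theta :: "nat \<Rightarrow> ('n::finite) option mpoly list \<Rightarrow> (real ^ 'n) set" where
  "modified_theta k H = {x. \<forall>l\<in>quad_module k H. linear_form l \<longrightarrow>
      peval l (\<lambda>i. case i of None \<Rightarrow> 1 | Some j \<Rightarrow> x $ j) \<ge> 0}"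

end

theory Submission
  imports Defs
begin

text \<open>
  A point \<open>x\<close> outside the closed convex hull of \<open>S\<close> lifts to a point \<open>(1, x)\<close> outside the
  closed pointed cone generated by the homogenized set. Hence \<open>0\<close> is not in the convex hull of
  \<open>- (1, x)\<close> and the spherical section of that set, so some linear form is
  negative at \<open>(1, x)\<close> and strictly positive on the spherical section. By Putinar's theorem this
  form lies in the quadratic module. Compactness of the ball minus the open \<open>\<epsilon>\<close>-neighbourhood
  of the hull leaves finitely many forms, so one degree bound serves all of them.

  Putinar's theorem is proved algebraically: modulo infinitesimals, a maximal proper archimedean
  quadratic module in a real polynomial ring is the set of polynomials nonnegative at a point, and an
  identity \<open>s f = 1 + q\<close> with \<open>s\<close> a sum of squares and \<open>q\<close> in an archimedean module puts
  \<open>f\<close> in that module.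
\<close>

section \<open>Archimedean quadratic modules\<close>

text \<open>Built one square at a time, so that closure properties follow by rule induction;
  \<open>is_sos_iff\<close> identifies this set with the list form \<open>is_sos\<close>.\<close>

inductive_set sos :: "'a::comm_ring_1 set" where
  zero: "0 \<in> sos"
| square: "s \<in> sos \<Longrightarrow> a * a + s \<in> sos"

lemma sos_add: "s \<in> sos \<Longrightarrow> t \<in> sos \<Longrightarrow> s + t \<in> sos"
  by (induction rule: sos.induct) (auto simp: add.assoc intro: sos.square)

lemma sos_square_mult: "s \<in> sos \<Longrightarrow> a * a * s \<in> sos"
proof (induction rule: sos.induct)
  case (square s b)
  have "a * a * (b * b + s) = (a * b) * (a * b) + a * a * s"
    by (simp add: algebra_simps)
  with square show ?case by (metis sos.square)
qed (simp add: sos.zero)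

lemma sos_one: "1 \<in> sos"
  using sos.square[OF sos.zero, of 1] by simp

definition quadratic_module :: "'a::comm_ring_1 set \<Rightarrow> bool" where
  "quadratic_module M \<longleftrightarrow>
     1 \<in> M \<and> (\<forall>p\<in>M. \<forall>q\<in>M. p + q \<in> M) \<and> (\<forall>a. \<forall>p\<in>M. a * a * p \<in> M)"

lemma quadratic_moduleD:
  assumes "quadratic_module M"
  shows "1 \<in> M" "p \<in> M \<Longrightarrow> q \<in> M \<Longrightarrow> p + q \<in> M" "p \<in> M \<Longrightarrow> a * a * p \<in> M"
  using assms by (auto simp: quadratic_module_def)

lemma quadratic_module_zero: "quadratic_module M \<Longrightarrow> 0 \<in> M"
  using quadratic_moduleD(3)[of M 1 0] quadratic_moduleD(1)[of M] by simp

lemma quadratic_module_sos_mult: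
  assumes "quadratic_module M" "s \<in> sos" "p \<in> M"
  shows "s * p \<in> M"
  using assms(2)
proof (induction rule: sos.induct)
  case zero
  then show ?case using quadratic_module_zero[OF assms(1)] by simp
next
  case (square s a)
  then show ?case
    using quadratic_moduleD(2,3)[OF assms(1)] assms(3) by (simp add: distrib_right)
qed

lemma quadratic_module_sos: "quadratic_module M \<Longrightarrow> s \<in> sos \<Longrightarrow> s \<in> M"
  using quadratic_module_sos_mult[of M s 1] quadratic_moduleD(1)[of M] by simp

text \<open>For a quadratic module \<open>M\<close>, this is the least quadratic module containing
  \<open>M\<close> and \<open>p\<close>.\<close>

definition adjoin :: "'a::comm_ring_1 \<Rightarrow> 'a set \<Rightarrow> 'a set" where
  "adjoin p M = {m + s * p | m s. m \<in> M \<and> s \<in> sos}"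

lemma quadratic_module_adjoin:
  assumes "quadratic_module M"
  shows "quadratic_module (adjoin p M)"
proof -
  note M = quadratic_moduleD[OF assms]
  have one: "1 \<in> adjoin p M"
    unfolding adjoin_def using M(1) sos.zero by force
  have add: "x + y \<in> adjoin p M" if xy: "x \<in> adjoin p M" "y \<in> adjoin p M" for x y
  proof -
    obtain m s m' s' where "x = m + s * p" "y = m' + s' * p" "m \<in> M" "s \<in> sos" "m' \<in> M" "s' \<in> sos"
      using xy by (auto simp: adjoin_def)
    moreover from this have "x + y = (m + m') + (s + s') * p"
      by (simp add: algebra_simps)
    ultimately show ?thesis
      unfolding adjoin_def using M(2) sos_add by blast
  qed
  have "a * a * x \<in> adjoin p M" if x: "x \<in> adjoin p M" for a x
  proof -
    obtain m s where "x = m + s * p" "m \<in> M" "s \<in> sos"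
      using x by (auto simp: adjoin_def)
    moreover from this have "a * a * x = a * a * m + (a * a * s) * p"
      by (simp add: algebra_simps)
    ultimately show ?thesis
      unfolding adjoin_def using M(3) sos_square_mult by blast
  qed
  with one add show ?thesis by (auto simp: quadratic_module_def)
qed

lemma adjoin_superset: "M \<subseteq> adjoin p M"
  unfolding adjoin_def using sos.zero by force

lemma adjoin_mem: "quadratic_module M \<Longrightarrow> p \<in> adjoin p M"
  unfolding adjoin_def using sos_one quadratic_module_zero[of M] by force

text \<open>Zorn's lemma applies: two elements of the union of a chain lie in a common member, and
  \<open>- 1\<close> lies in no member.\<close>

lemma proper_quadratic_module_maximal:
  assumes "quadratic_module Q" "- 1 \<notin> Q"
  obtains M where "quadratic_module M" "Q \<subseteq> M" "- 1 \<notin> M"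
    "\<And>N. quadratic_module N \<Longrightarrow> M \<subseteq> N \<Longrightarrow> - 1 \<notin> N \<Longrightarrow> N = M"
proof -
  define A where "A = {M. quadratic_module M \<and> Q \<subseteq> M \<and> - 1 \<notin> M}"
  have "\<exists>M\<in>A. \<forall>X\<in>A. M \<subseteq> X \<longrightarrow> X = M"
  proof (rule subset_Zorn_nonempty)
    show "A \<noteq> {}" using assms by (auto simp: A_def)
  next
    fix C assume C: "C \<noteq> {}" "subset.chain A C"
    then have CA: "\<And>M. M \<in> C \<Longrightarrow> quadratic_module M \<and> Q \<subseteq> M \<and> - 1 \<notin> M"
      by (auto simp: subset.chain_def A_def)
    have "p + q \<in> \<Union>C" if pq: "p \<in> \<Union>C" "q \<in> \<Union>C" for p q
    proof -
      obtain M N where MN: "M \<in> C" "N \<in> C" "p \<in> M" "q \<in> N" using pq by auto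
      then have "M \<subseteq> N \<or> N \<subseteq> M" using C(2) by (auto simp: subset.chain_def)
      then show ?thesis using MN quadratic_moduleD(2) CA by blast
    qed
    moreover have "1 \<in> \<Union>C" "Q \<subseteq> \<Union>C" using C(1) CA quadratic_moduleD(1) by blast+
    moreover have "a * a * p \<in> \<Union>C" if "p \<in> \<Union>C" for a p
      using that CA quadratic_moduleD(3) by blast
    moreover have "- 1 \<notin> \<Union>C" using CA by blast
    ultimately show "\<Union>C \<in> A" by (simp add: A_def quadratic_module_def)
  qed
  then show ?thesis using that unfolding A_def by (smt (verit) mem_Collect_eq order_trans)
qed

text \<open>The archimedean theory asks only for a unital ring homomorphism from the reals; it is
  instantiated once, with the constant polynomials \<open>pconst\<close>.\<close>

locale real_constants =
  fixes c :: "real \<Rightarrow> 'a::comm_ring_1"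
  assumes c_add: "c (s + t) = c s + c t"
    and c_mult: "c (s * t) = c s * c t"
    and c_one: "c 1 = 1"
begin

lemma c_zero: "c 0 = 0"
  using c_add[of 0 0] by simp

lemma c_minus: "c (- t) = - c t"
  using c_add[of t "- t"] c_zero by (simp add: eq_neg_iff_add_eq_0 add.commute)

lemma c_diff: "c (s - t) = c s - c t"
  using c_add[of s "- t"] c_minus by simp

lemmas c_simps = c_add c_mult c_one c_zero c_minus c_diff

lemma c_scale_mem:
  assumes "quadratic_module M" "t \<ge> 0" "p \<in> M"
  shows "c t * p \<in> M"
proof -
  have "c t = c (sqrt t) * c (sqrt t)" using assms(2) by (simp flip: c_mult)
  then show ?thesis using quadratic_moduleD(3)[OF assms(1,3)] by simp
qed

lemma c_nonneg_mem: "quadratic_module M \<Longrightarrow> t \<ge> 0 \<Longrightarrow> c t \<in> M"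
  using c_scale_mem[of M t 1] quadratic_moduleD(1)[of M] by simp

lemma c_descale_mem:
  assumes "quadratic_module M" "t > 0" "c t * p \<in> M"
  shows "p \<in> M"
proof -
  have "c (1 / t) * (c t * p) = c (1 / t * t) * p" by (simp only: c_mult mult.assoc)
  also have "\<dots> = p" using assms(2) by (simp add: c_one)
  finally show ?thesis using c_scale_mem[OF assms(1) _ assms(3), of "1 / t"] assms(2) by simp
qed

lemma c_mem_iff:
  assumes "quadratic_module M" "- 1 \<notin> M"
  shows "c t \<in> M \<longleftrightarrow> t \<ge> 0"
proof
  assume "c t \<in> M"
  show "t \<ge> 0"
  proof (rule ccontr)
    assume "\<not> t \<ge> 0"
    then have "c (- t) * (- 1) \<in> M" "- t > 0" using \<open>c t \<in> M\<close> by (simp_all add: c_minus)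
    then show False using c_descale_mem[OF assms(1)] assms(2) by blast
  qed
qed (use c_nonneg_mem[OF assms(1)] in blast)

text \<open>The support of \<open>M\<close>, its intersection with its negative, is an ideal:
  \<open>4 a = (a + 1)^2 - (a - 1)^2\<close> writes any multiplier as a difference of squares, up to
  a positive factor.\<close>

lemma quadratic_module_support_mult:
  fixes M :: "'a set"
  assumes "quadratic_module M" "p \<in> M" "- p \<in> M"
  shows "a * p \<in> M"
proof -
  note M = quadratic_moduleD[OF assms(1)]
  have "c 4 * (a * p) = (a + 1) * (a + 1) * p + (a - 1) * (a - 1) * (- p)"
    using c_add[of 2 2] c_add[of 1 1] by (simp add: algebra_simps c_one)
  then have "c 4 * (a * p) \<in> M" using M(2,3) assms(2,3) by metis
  then show ?thesis using c_descale_mem[OF assms(1), of 4] by simp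
qed

text \<open>Otherwise maximality puts \<open>- 1\<close> into both \<open>adjoin p M\<close> and
  \<open>adjoin (- p) M\<close>. Eliminating \<open>p\<close> from the two identities places
  \<open>s1\<close> in the support, so \<open>s1 * p\<close> lies in \<open>M\<close>, and the first
  identity then gives \<open>- 1\<close> in \<open>M\<close>.\<close>

lemma maximal_quadratic_module_total:
  fixes M :: "'a set"
  assumes M: "quadratic_module M" "- 1 \<notin> M"
    and max: "\<And>N. quadratic_module N \<Longrightarrow> M \<subseteq> N \<Longrightarrow> - 1 \<notin> N \<Longrightarrow> N = M"
  shows "p \<in> M \<or> - p \<in> M"
proof (rule ccontr)
  assume not: "\<not> (p \<in> M \<or> - p \<in> M)"
  have *: "- 1 \<in> adjoin q M" if "q \<notin> M" for q
    using max[OF quadratic_module_adjoin[OF M(1)] adjoin_superset] adjoin_mem[OF M(1)] that by metis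
  obtain m1 s1 where 1: "- 1 = m1 + s1 * p" "m1 \<in> M" "s1 \<in> sos"
    using *[of p] not by (auto simp: adjoin_def)
  obtain m2 s2 where 2: "- 1 = m2 + s2 * (- p)" "m2 \<in> M" "s2 \<in> sos"
    using *[of "- p"] not by (auto simp: adjoin_def)
  \<comment> \<open>The identities are multiplied by \<open>s2\<close> and \<open>s1\<close> to give
    two values of \<open>s1 * s2 * p\<close>.\<close>
  have "s2 * (s1 * p) = s2 * (- 1 - m1)" using 1(1) by (simp add: algebra_simps)
  moreover have "s1 * (s2 * p) = s1 * (1 + m2)" using 2(1) by (simp add: algebra_simps)
  ultimately have "s1 * (1 + m2) = s2 * (- 1 - m1)" by (metis mult.left_commute)
  then have "- s1 = s1 * m2 + s2 + s2 * m1"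
    by (simp add: algebra_simps neg_eq_iff_add_eq_0) (simp add: eq_neg_iff_add_eq_0 algebra_simps)
  also have "\<dots> \<in> M"
    by (intro quadratic_moduleD(2)[OF M(1)] quadratic_module_sos_mult[OF M(1)]
        quadratic_module_sos[OF M(1)] 1 2)
  finally have "- s1 \<in> M" .
  then have "p * s1 \<in> M"
    using quadratic_module_support_mult[OF M(1)] quadratic_module_sos[OF M(1) 1(3)] by blast
  then show False using 1 quadratic_moduleD(2)[OF M(1)] M(2) by (metis mult.commute)
qed

text \<open>A quadratic module need not be closed under products, so \<open>(n - p) (n + p)\<close>
  is reached, up to the factor \<open>2 * n\<close>, as a sum of the two bounds weighted by
  squares.\<close>

lemma quadratic_module_square_bound:
  assumes "quadratic_module M" "n > 0" "c n - p \<in> M" "c n + p \<in> M"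
  shows "c (n * n) - p * p \<in> M"
proof -
  note M = quadratic_moduleD[OF assms(1)]
  have "c (2 * n) * (c (n * n) - p * p) =
     (c n + p) * (c n + p) * (c n - p) + (c n - p) * (c n - p) * (c n + p)"
    using c_add[of n n] by (simp add: algebra_simps c_mult)
  then have "c (2 * n) * (c (n * n) - p * p) \<in> M" using M(2,3) assms(3,4) by metis
  then show ?thesis using c_descale_mem[OF assms(1), of "2 * n"] assms(2) by simp
qed

section \<open>The subring of elements bounded by constants\<close>

definition bounded_by_constants :: "'a set \<Rightarrow> 'a set" where
  "bounded_by_constants M = {p. \<exists>n. c n - p \<in> M \<and> c n + p \<in> M}"

lemma bounded_by_constants_posE:
  assumes "quadratic_module M" "p \<in> bounded_by_constants M"
  obtains n where "n > 0" "c n - p \<in> M" "c n + p \<in> M"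
proof -
  obtain n where n: "c n - p \<in> M" "c n + p \<in> M" using assms(2) by (auto simp: bounded_by_constants_def)
  \<comment> \<open>A bound of at least 1 is positive, as later division by it requires.\<close>
  have "c (max n 1 - n) + (c n - p) \<in> M" "c (max n 1 - n) + (c n + p) \<in> M"
    using n c_nonneg_mem[OF assms(1), of "max n 1 - n"] quadratic_moduleD(2)[OF assms(1)] by simp_all
  then show ?thesis
    using that[of "max n 1"] by (simp add: c_diff algebra_simps)
qed

lemma bounded_by_constants_const: "quadratic_module M \<Longrightarrow> c t \<in> bounded_by_constants M"
  unfolding bounded_by_constants_def
  using c_nonneg_mem[of M "\<bar>t\<bar> - t"] c_nonneg_mem[of M "\<bar>t\<bar> + t"] by (auto simp: c_diff c_add intro!: exI[of _ "\<bar>t\<bar>"])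

lemma bounded_by_constants_add:
  assumes "quadratic_module M" "p \<in> bounded_by_constants M" "q \<in> bounded_by_constants M"
  shows "p + q \<in> bounded_by_constants M"
proof -
  obtain n m where nm: "c n - p \<in> M" "c n + p \<in> M" "c m - q \<in> M" "c m + q \<in> M"
    using assms(2,3) by (auto simp: bounded_by_constants_def)
  have "c (n + m) - (p + q) = (c n - p) + (c m - q)" "c (n + m) + (p + q) = (c n + p) + (c m + q)"
    by (simp_all add: c_add)
  then show ?thesis
    unfolding bounded_by_constants_def using nm quadratic_moduleD(2)[OF assms(1)]
    by (metis (mono_tags, lifting) mem_Collect_eq)
qed

lemma bounded_by_constants_minus: "p \<in> bounded_by_constants M \<Longrightarrow> - p \<in> bounded_by_constants M"
  unfolding bounded_by_constants_def by auto

lemma bounded_by_constants_scale: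
  assumes "quadratic_module M" "t \<ge> 0" "p \<in> bounded_by_constants M"
  shows "c t * p \<in> bounded_by_constants M"
proof -
  obtain n where n: "c n - p \<in> M" "c n + p \<in> M"
    using assms(3) by (auto simp: bounded_by_constants_def)
  have "c (t * n) - c t * p = c t * (c n - p)" "c (t * n) + c t * p = c t * (c n + p)"
    by (simp_all add: c_mult algebra_simps)
  then show ?thesis
    unfolding bounded_by_constants_def using n c_scale_mem[OF assms(1,2)]
    by (metis (mono_tags, lifting) mem_Collect_eq)
qed

lemma bounded_by_constants_square:
  assumes "quadratic_module M" "p \<in> bounded_by_constants M"
  shows "p * p \<in> bounded_by_constants M"
proof -
  obtain n where n: "n > 0" "c n - p \<in> M" "c n + p \<in> M"
    using bounded_by_constants_posE[OF assms] by metis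
  have "p * p * 1 \<in> M" using quadratic_moduleD[OF assms(1)] by blast
  then have "c (n * n) + p * p \<in> M"
    using c_nonneg_mem[OF assms(1), of "n * n"] quadratic_moduleD(2)[OF assms(1)] by simp
  then show ?thesis
    using quadratic_module_square_bound[OF assms(1) n] by (auto simp: bounded_by_constants_def)
qed

text \<open>Reduces closure under products to closure under squares. Only sums and unary minus
  occur, so that the closure rules apply to the right-hand side syntactically.\<close>

lemma mult_eq_polarization:
  "p * q = c (1/2) * ((p + q) * (p + q) + (- (p * p) + - (q * q)))"
proof -
  have "(p + q) * (p + q) + (- (p * p) + - (q * q)) = c 2 * (p * q)"
    using c_add[of 1 1] by (simp add: algebra_simps c_one)
  then have "c (1/2) * ((p + q) * (p + q) + (- (p * p) + - (q * q))) = c (1/2 * 2) * (p * q)"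
    by (simp only: c_mult mult.assoc)
  then show ?thesis by (simp add: c_one)
qed

text \<open>With this, bounds on the variables extend to all polynomials; that every element is
  bounded is the archimedean property.\<close>

lemma bounded_by_constants_mult:
  assumes "quadratic_module M" "p \<in> bounded_by_constants M" "q \<in> bounded_by_constants M"
  shows "p * q \<in> bounded_by_constants M"
  unfolding mult_eq_polarization[of p q]
  by (intro bounded_by_constants_scale bounded_by_constants_add bounded_by_constants_minus
      bounded_by_constants_square assms) simp

section \<open>Infinitesimal elements and standard parts\<close>

definition infinitesimal :: "'a set \<Rightarrow> 'a set" where
  "infinitesimal M = {p. \<forall>e>0. c e - p \<in> M \<and> c e + p \<in> M}"

lemma infinitesimal_add:
  assumes "quadratic_module M" "p \<in> infinitesimal M" "q \<in> infinitesimal M"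
  shows "p + q \<in> infinitesimal M"
proof -
  have "c e - (p + q) \<in> M \<and> c e + (p + q) \<in> M" if "e > 0" for e
  proof -
    have "c (e / 2) - p \<in> M" "c (e / 2) + p \<in> M" "c (e / 2) - q \<in> M" "c (e / 2) + q \<in> M"
      using assms(2,3) that by (auto simp: infinitesimal_def)
    then have "(c (e / 2) - p) + (c (e / 2) - q) \<in> M" "(c (e / 2) + p) + (c (e / 2) + q) \<in> M"
      using quadratic_moduleD(2)[OF assms(1)] by blast+
    moreover have "c e = c (e / 2) + c (e / 2)" by (simp flip: c_add)
    ultimately show ?thesis by (simp add: algebra_simps)
  qed
  then show ?thesis by (simp add: infinitesimal_def)
qed

lemma infinitesimal_minus: "p \<in> infinitesimal M \<Longrightarrow> - p \<in> infinitesimal M"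
  unfolding infinitesimal_def by auto

lemma infinitesimal_zero: "quadratic_module M \<Longrightarrow> 0 \<in> infinitesimal M"
  unfolding infinitesimal_def using c_nonneg_mem by auto

lemma infinitesimal_scale:
  assumes "quadratic_module M" "p \<in> infinitesimal M"
  shows "c t * p \<in> infinitesimal M"
proof -
  have pos: "c t * p \<in> infinitesimal M" if "t > 0" for t
  proof -
    have "c e - c t * p \<in> M \<and> c e + c t * p \<in> M" if "e > 0" for e
    proof -
      have "c (e / t) - p \<in> M" "c (e / t) + p \<in> M"
        using assms(2) \<open>t > 0\<close> that by (auto simp: infinitesimal_def)
      then have "c t * (c (e / t) - p) \<in> M" "c t * (c (e / t) + p) \<in> M"
        using c_scale_mem[OF assms(1)] \<open>t > 0\<close> by simp_all
      moreover have "c t * c (e / t) = c e" using \<open>t > 0\<close> by (simp flip: c_mult)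
      ultimately show ?thesis by (simp add: algebra_simps)
    qed
    then show ?thesis by (simp add: infinitesimal_def)
  qed
  consider "t > 0" | "t = 0" | "- t > 0" by linarith
  then show ?thesis
  proof cases
    case 3
    then show ?thesis using infinitesimal_minus[OF pos[OF 3]] by (simp add: c_minus)
  qed (use pos infinitesimal_zero[OF assms(1)] in \<open>auto simp: c_zero\<close>)
qed

lemma infinitesimal_square:
  assumes "quadratic_module M" "p \<in> infinitesimal M"
  shows "p * p \<in> infinitesimal M"
proof -
  have "c e - p * p \<in> M \<and> c e + p * p \<in> M" if e: "e > 0" for e
  proof
    \<comment> \<open>The bound \<open>sqrt e\<close> squares to \<open>e\<close> in
      \<open>quadratic_module_square_bound\<close>.\<close>
    have "c (sqrt e) - p \<in> M" "c (sqrt e) + p \<in> M"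
      using assms(2) e by (auto simp: infinitesimal_def)
    then show "c e - p * p \<in> M"
      using quadratic_module_square_bound[OF assms(1), of "sqrt e" p] e by simp
    have "p * p * 1 \<in> M" using quadratic_moduleD[OF assms(1)] by blast
    then show "c e + p * p \<in> M"
      using c_nonneg_mem[OF assms(1), of e] quadratic_moduleD(2)[OF assms(1)] e by simp
  qed
  then show ?thesis by (simp add: infinitesimal_def)
qed

lemma infinitesimal_mult:
  assumes "quadratic_module M" "p \<in> infinitesimal M" "q \<in> infinitesimal M"
  shows "p * q \<in> infinitesimal M"
  unfolding mult_eq_polarization[of p q]
  by (intro infinitesimal_scale infinitesimal_add infinitesimal_minus infinitesimal_square assms)

text \<open>The witness is the supremum of a Dedekind cut, the constants \<open>t\<close> with
  \<open>p - c t\<close> in \<open>M\<close>. The bounds on \<open>p\<close> make the cut nonempty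
  and bounded above; totality turns non-membership above the supremum into the reverse
  inequality.\<close>

lemma standard_part_exists:
  assumes M: "quadratic_module M" "- 1 \<notin> M"
    and total: "\<And>p. p \<in> M \<or> - p \<in> M"
    and arch: "p \<in> bounded_by_constants M"
  shows "\<exists>t. p - c t \<in> infinitesimal M"
proof -
  define A where "A = {t. p - c t \<in> M}"
  obtain n where n: "c n - p \<in> M" "c n + p \<in> M" using arch by (auto simp: bounded_by_constants_def)
  have up: "t \<le> n" if "t \<in> A" for t
  proof -
    have "(p - c t) + (c n - p) \<in> M" using quadratic_moduleD(2)[OF M(1) _ n(1)] that unfolding A_def by blast
    then have "c (n - t) \<in> M" by (simp add: c_diff)
    then show ?thesis using c_mem_iff[OF M] by simp
  qed
  have ne: "- n \<in> A" using n(2) by (simp add: A_def c_minus add.commute)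
  have bdd: "bdd_above A" using up by (auto simp: bdd_above_def)
  have "c e - (p - c (Sup A)) \<in> M \<and> c e + (p - c (Sup A)) \<in> M" if e: "e > 0" for e
  proof
    have "Sup A + e \<notin> A" using cSup_upper[OF _ bdd, of "Sup A + e"] e by auto
    then have "- (p - c (Sup A + e)) \<in> M" using total A_def by blast
    then show "c e - (p - c (Sup A)) \<in> M" by (simp add: c_add algebra_simps)
    obtain t where t: "t \<in> A" "Sup A - e < t"
      using less_cSup_iff[OF _ bdd, of "Sup A - e"] ne e by auto
    have "(p - c t) + c (t - (Sup A - e)) \<in> M"
      using t quadratic_moduleD(2)[OF M(1)] c_nonneg_mem[OF M(1), of "t - (Sup A - e)"]
      by (simp add: A_def)
    then show "c e + (p - c (Sup A)) \<in> M" by (simp add: c_simps algebra_simps)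
  qed
  then show ?thesis by (auto simp: infinitesimal_def)
qed

text \<open>Adding \<open>c e - (p - c t)\<close> to \<open>p\<close> leaves
  \<open>c (t + e)\<close> in \<open>M\<close>, and a proper module contains no negative
  constant.\<close>

lemma infinitesimal_approx_nonneg:
  assumes M: "quadratic_module M" "- 1 \<notin> M" and p: "p \<in> M" "p - c t \<in> infinitesimal M"
  shows "t \<ge> 0"
proof (rule field_le_epsilon)
  fix e :: real assume "e > 0"
  then have "c e - (p - c t) \<in> M" using p(2) by (auto simp: infinitesimal_def)
  then have "c e - (p - c t) + p \<in> M" using p(1) quadratic_moduleD(2)[OF M(1)] by blast
  then have "c (t + e) \<in> M" by (simp add: c_add algebra_simps)
  then show "0 \<le> t + e" using c_mem_iff[OF M] by blast
qed

text \<open>Woermann's trick: the constant \<open>r\<close> in \<open>f + r \<in> Q\<close> can be lowered by a fixed amount \<open>1 / k\<^sup>2\<close>.\<close>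

lemma mem_if_sos_multiple:
  assumes Q: "quadratic_module Q" and arch: "\<And>p. p \<in> bounded_by_constants Q"
    and s: "s \<in> sos" and sf: "s * f - 1 \<in> Q"
  shows "f \<in> Q"
proof -
  note Q' = quadratic_moduleD[OF Q]
  obtain n1 where n1: "n1 > 0" "c n1 - s \<in> Q" using bounded_by_constants_posE[OF Q arch] by metis
  obtain n2 where n2: "n2 > 0" "c n2 - (s * s * f + 1) \<in> Q" using bounded_by_constants_posE[OF Q arch] by metis
  \<comment> \<open>Chosen so that \<open>2 * k\<close> bounds both \<open>s\<close> and
    \<open>s * s * f + 1\<close>.\<close>
  define k where "k = (n1 + n2) / 2"
  have k: "k > 0" "2 * k = n1 + n2" using n1 n2 by (simp_all add: k_def)
  have k1: "c (2 * k) - s \<in> Q"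
    using Q'(2)[OF n1(2) c_nonneg_mem[OF Q, of n2]] n2(1) unfolding k(2) by (simp add: c_add algebra_simps)
  have k2: "c (2 * k) - (s * s * f + 1) \<in> Q"
    using Q'(2)[OF n2(2) c_nonneg_mem[OF Q, of n1]] n1(1) unfolding k(2) by (simp add: c_add algebra_simps)
  have step: "f + c (r - 1 / (k * k)) \<in> Q" if r: "f + c r \<in> Q" "r \<ge> 0" for r
  proof -
    have two: "c (2 * k) = c k + c k" using c_add[of k k] by simp
    have kk: "c k * c k * c (1 / (k * k)) = 1" using k by (simp add: c_one flip: c_mult)
    have "c (k * k) * (f + c (r - 1 / (k * k))) = c k * c k * (f + c r) - c k * c k * c (1 / (k * k))"
      by (simp add: c_mult c_diff algebra_simps)
    also have "\<dots> = c k * c k * (f + c r) - 1" by (simp only: kk)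
    \<comment> \<open>Replacing \<open>k^2\<close> by \<open>(k - s)^2\<close> loses
      \<open>s (2 k - s) (f + r)\<close>. Its \<open>r\<close> part is a nonnegative multiple of
      \<open>s (2 k - s)\<close>; its \<open>f\<close> part, together with \<open>- 1\<close>, is
      the last bracket.\<close>
    also have "\<dots> = (c k - s) * (c k - s) * (f + c r) + c r * (s * (c (2 * k) - s))
        + (c (2 * k) * (s * f - 1) + (c (2 * k) - (s * s * f + 1)))"
      unfolding two by (simp add: algebra_simps)
    also have "\<dots> \<in> Q"
      using k r by (intro r(1) k1 k2 sf Q' c_scale_mem[OF Q] quadratic_module_sos_mult[OF Q s]) simp_all
    finally show ?thesis using c_descale_mem[OF Q, of "k * k"] k by simp
  qed
  obtain r0 where r0: "c r0 + f \<in> Q" using bounded_by_constants_posE[OF Q arch] by metis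
  have low: "f \<in> Q" if "f + c r \<in> Q" "r \<le> 0" for r
    using Q'(2)[OF that(1) c_nonneg_mem[OF Q, of "- r"]] that(2) by (simp add: c_minus)
  define d where "d = 1 / (k * k)"
  have d: "d > 0" using k by (simp add: d_def)
  \<comment> \<open>The first alternative covers constants that are already nonpositive, where
    \<open>step\<close> may no longer apply.\<close>
  have iter: "f \<in> Q \<or> f + c (r0 - real n * d) \<in> Q" for n
  proof (induction n)
    case 0
    then show ?case using r0 by (simp add: add.commute)
  next
    case (Suc n)
    have "r0 - real (Suc n) * d = r0 - real n * d - d"
      by (simp add: algebra_simps)
    with Suc step[of "r0 - real n * d", folded d_def] low[of "r0 - real n * d"] show ?case
      by (metis linear)
  qed
  obtain n where "r0 < real n * d" using ex_less_of_nat_mult[OF d] by auto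
  with iter[of n] low show ?thesis by force
qed

text \<open>If \<open>- 1\<close> were in \<open>adjoin (- f) Q\<close>, then
  \<open>s * f - 1\<close> would lie in \<open>Q\<close> for some sum of squares \<open>s\<close>,
  forcing \<open>f\<close> into \<open>Q\<close>. So a maximal proper module contains
  \<open>Q\<close> and \<open>- f\<close>, and it has standard parts. Here \<open>\<phi>\<close> is
  merely chosen for each \<open>p\<close> separately; its values on the variables will define a
  point.\<close>

theorem archimedean_module_separation:
  assumes Q: "quadratic_module Q" and arch: "\<And>p. p \<in> bounded_by_constants Q"
    and neg: "f \<notin> Q"
  obtains M \<phi> where "quadratic_module M" "Q \<subseteq> M" "- 1 \<notin> M" "- f \<in> M"
    "\<And>p. p - c (\<phi> p) \<in> infinitesimal M"
proof -
  have "- 1 \<notin> adjoin (- f) Q"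
  proof
    assume "- 1 \<in> adjoin (- f) Q"
    then obtain m s where "- 1 = m + s * (- f)" "m \<in> Q" "s \<in> sos" by (auto simp: adjoin_def)
    then have "s * f - 1 \<in> Q" "s \<in> sos" by (auto simp: algebra_simps)
    then show False using mem_if_sos_multiple[OF Q arch] neg by blast
  qed
  then obtain M where M: "quadratic_module M" "adjoin (- f) Q \<subseteq> M" "- 1 \<notin> M"
    "\<And>N. quadratic_module N \<Longrightarrow> M \<subseteq> N \<Longrightarrow> - 1 \<notin> N \<Longrightarrow> N = M"
    using proper_quadratic_module_maximal[OF quadratic_module_adjoin[OF Q]] by metis
  have QM: "Q \<subseteq> M" using adjoin_superset M(2) by blast
  have "p \<in> bounded_by_constants M" for p
    using arch[of p] QM by (auto simp: bounded_by_constants_def)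
  then have "\<exists>t. p - c t \<in> infinitesimal M" for p
    using standard_part_exists[OF M(1,3) maximal_quadratic_module_total[OF M(1,3,4)]] by blast
  then obtain \<phi> where "\<And>p. p - c (\<phi> p) \<in> infinitesimal M" by metis
  then show ?thesis using that[OF M(1) QM M(3)] M(2) adjoin_mem[OF Q, of "- f"] by blast
qed

end

section \<open>Putinar's theorem for real polynomials\<close>

abbreviation mono_eval :: "('v \<Rightarrow>\<^sub>0 nat) \<Rightarrow> ('v \<Rightarrow> real) \<Rightarrow> real" where
  "mono_eval m v \<equiv> \<Prod>i\<in>Poly_Mapping.keys m. v i ^ Poly_Mapping.lookup m i"

lemma mono_eval_superset:
  assumes "finite A" "Poly_Mapping.keys m \<subseteq> A"
  shows "mono_eval m v = (\<Prod>i\<in>A. v i ^ Poly_Mapping.lookup m i)"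
  by (rule prod.mono_neutral_left[OF assms]) (auto simp: in_keys_iff)

lemma mono_eval_add: "mono_eval (m + n) v = mono_eval m v * mono_eval n v"
proof -
  let ?A = "Poly_Mapping.keys m \<union> Poly_Mapping.keys n"
  have "mono_eval (m + n) v = (\<Prod>i\<in>?A. v i ^ Poly_Mapping.lookup (m + n) i)"
    by (intro mono_eval_superset) (auto simp: keys_add)
  also have "\<dots> = (\<Prod>i\<in>?A. v i ^ Poly_Mapping.lookup m i) * (\<Prod>i\<in>?A. v i ^ Poly_Mapping.lookup n i)"
    by (simp add: lookup_add power_add prod.distrib)
  also have "\<dots> = mono_eval m v * mono_eval n v"
    using mono_eval_superset[of ?A m v] mono_eval_superset[of ?A n v] by simp
  finally show ?thesis .
qed

lemma mono_eval_single: "mono_eval (Poly_Mapping.single i n) v = v i ^ n"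
  by (cases "n = 0") simp_all

lemma mono_eval_sum:
  "finite I \<Longrightarrow> mono_eval (\<Sum>i\<in>I. f i) v = (\<Prod>i\<in>I. mono_eval (f i) v)"
  by (induction I rule: finite_induct) (simp_all add: mono_eval_add)

lemma peval_superset:
  assumes "finite A" "Poly_Mapping.keys p \<subseteq> A"
  shows "peval p v = (\<Sum>m\<in>A. Poly_Mapping.lookup p m * mono_eval m v)"
  unfolding peval_def by (rule sum.mono_neutral_left[OF assms]) (auto simp: in_keys_iff)

lemma peval_add: "peval (p + q) v = peval p v + peval q v"
proof -
  let ?A = "Poly_Mapping.keys p \<union> Poly_Mapping.keys q"
  have "peval (p + q) v = (\<Sum>m\<in>?A. Poly_Mapping.lookup (p + q) m * mono_eval m v)"
    by (intro peval_superset) (auto simp: keys_add)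
  then show ?thesis
    using peval_superset[of ?A p v] peval_superset[of ?A q v]
    by (simp add: lookup_add distrib_right sum.distrib)
qed

lemma peval_single: "peval (Poly_Mapping.single m t) v = t * mono_eval m v"
  by (cases "t = 0") (simp_all add: peval_def)

lemma peval_zero: "peval 0 v = 0"
  by (simp add: peval_def)

lemma peval_sum: "peval (\<Sum>i\<in>I. f i) v = (\<Sum>i\<in>I. peval (f i) v)"
  by (induction I rule: infinite_finite_induct) (simp_all add: peval_zero peval_add)

lemma poly_mapping_eq_sum_single:
  fixes p :: "'a \<Rightarrow>\<^sub>0 'b::comm_monoid_add"
  shows "p = (\<Sum>m\<in>Poly_Mapping.keys p. Poly_Mapping.single m (Poly_Mapping.lookup p m))"
  by (rule poly_mapping_eqI) (simp add: lookup_sum lookup_single when_def in_keys_iff)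

text \<open>General in the index and value types, so that it serves both polynomials and their
  exponent vectors.\<close>

lemma poly_mapping_single_induct [case_names zero single add]:
  fixes p :: "'a \<Rightarrow>\<^sub>0 'b::comm_monoid_add"
  assumes "P 0" "\<And>m t. P (Poly_Mapping.single m t)" "\<And>p q. P p \<Longrightarrow> P q \<Longrightarrow> P (p + q)"
  shows "P p"
proof -
  have "P (\<Sum>m\<in>I. Poly_Mapping.single m (Poly_Mapping.lookup p m))" for I
    by (induction I rule: infinite_finite_induct) (auto intro: assms)
  then show ?thesis using poly_mapping_eq_sum_single[of p] by metis
qed

lemma peval_mult: "peval (p * q) v = peval p v * peval q v"
proof (induction p rule: poly_mapping_single_induct)
  case (single m t)
  show ?case
    by (induction q rule: poly_mapping_single_induct)
      (simp_all add: peval_zero peval_add mult_single peval_single mono_eval_add algebra_simps)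
qed (simp_all add: peval_zero peval_add distrib_right)

lemma peval_minus: "peval (- p) v = - peval p v"
  using peval_add[of p "- p" v] by (simp add: peval_zero)

lemma peval_diff: "peval (p - q) v = peval p v - peval q v"
  using peval_add[of p "- q" v] by (simp add: peval_minus)

definition pconst :: "real \<Rightarrow> 'v mpoly" where
  "pconst t = Poly_Mapping.single 0 t"

lemma peval_pconst: "peval (pconst t) v = t"
  by (simp add: pconst_def peval_single)

lemma peval_one: "peval 1 v = 1"
  using peval_pconst[of 1 v] by (simp add: pconst_def)

lemma peval_pvar: "peval (pvar i) v = v i"
  by (simp add: pvar_def peval_single)

interpretation pconst: real_constants pconst
  by standard (simp_all add: pconst_def single_add mult_single)

text \<open>Serves to extend boundedness, and later congruence with the value at a point, from the
  variables to all polynomials.\<close>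

lemma mpoly_algebra_induct [case_names const var add mult]:
  assumes const: "\<And>t. P (pconst t)" and var: "\<And>i. P (pvar i)"
    and add: "\<And>p q. P p \<Longrightarrow> P q \<Longrightarrow> P (p + q)" and mult: "\<And>p q. P p \<Longrightarrow> P q \<Longrightarrow> P (p * q)"
  shows "P p"
proof (induction p rule: poly_mapping_single_induct)
  case zero
  then show ?case using const[of 0] by (simp add: pconst_def)
next
  case (single m t)
  have one: "P 1" using const[of 1] by (simp add: pconst_def)
  have pow: "P (Poly_Mapping.single (Poly_Mapping.single i n) 1)" for i n
  proof (induction n)
    case (Suc n)
    have "Poly_Mapping.single (Poly_Mapping.single i (Suc n)) (1::real) =
        pvar i * Poly_Mapping.single (Poly_Mapping.single i n) 1"
      by (simp add: pvar_def mult_single flip: single_add)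
    then show ?case using mult[OF var Suc] by simp
  qed (use one in simp)
  have "P (Poly_Mapping.single m 1)"
  proof (induction m rule: poly_mapping_single_induct)
    case (add m n)
    then show ?case using mult[OF add] by (simp add: mult_single)
  qed (use one pow in simp_all)
  then have "P (pconst t * Poly_Mapping.single m 1)" by (intro mult const)
  then show ?case by (simp add: pconst_def mult_single)
qed (rule add)

text \<open>If \<open>f\<close> is not in \<open>Q\<close>, some maximal proper \<open>M\<close>
  contains \<open>Q\<close> and \<open>- f\<close>. The standard parts of the variables form a point
  \<open>x\<close>, and every \<open>p\<close> is congruent to \<open>peval p x\<close> modulo
  infinitesimals. Hence all of \<open>M\<close> is nonnegative at \<open>x\<close>, which
  contradicts positivity of \<open>f\<close> there.\<close>

theorem putinar_positivstellensatz:
  fixes Q :: "'v mpoly set"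
  assumes Q: "quadratic_module Q" and vars: "\<And>i. pvar i \<in> pconst.bounded_by_constants Q"
    and pos: "\<And>x. (\<And>q. q \<in> Q \<Longrightarrow> peval q x \<ge> 0) \<Longrightarrow> peval f x > 0"
  shows "f \<in> Q"
proof (rule ccontr)
  have arch: "p \<in> pconst.bounded_by_constants Q" for p
    by (induction p rule: mpoly_algebra_induct)
      (auto intro: Q vars pconst.bounded_by_constants_const pconst.bounded_by_constants_add
        pconst.bounded_by_constants_mult)
  assume "f \<notin> Q"
  then obtain M \<phi> where M: "quadratic_module M" "Q \<subseteq> M" "- 1 \<notin> M" "- f \<in> M"
    and \<phi>: "\<And>p. p - pconst (\<phi> p) \<in> pconst.infinitesimal M"
    using pconst.archimedean_module_separation[OF Q arch] by metis
  define x where "x i = \<phi> (pvar i)" for i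
  have x: "p - pconst (peval p x) \<in> pconst.infinitesimal M" for p
  proof (induction p rule: mpoly_algebra_induct)
    case (const t)
    then show ?case by (simp add: peval_pconst pconst.infinitesimal_zero[OF M(1)])
  next
    case (var i)
    then show ?case using \<phi> by (simp add: peval_pvar x_def)
  next
    case (add p q)
    have "p + q - pconst (peval (p + q) x) = (p - pconst (peval p x)) + (q - pconst (peval q x))"
      by (simp add: peval_add pconst.c_add)
    then show ?case using pconst.infinitesimal_add[OF M(1) add] by metis
  next
    case (mult p q)
    \<comment> \<open>This expansion uses only products of infinitesimals and their real multiples,
      so infinitesimals need not absorb arbitrary factors.\<close>
    have "p * q - pconst (peval (p * q) x) =
        (p - pconst (peval p x)) * (q - pconst (peval q x)) +
        (pconst (peval q x) * (p - pconst (peval p x)) + pconst (peval p x) * (q - pconst (peval q x)))"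
      by (simp add: peval_mult pconst.c_mult algebra_simps)
    then show ?case
      by (auto intro!: pconst.infinitesimal_add pconst.infinitesimal_mult pconst.infinitesimal_scale M(1) mult)
  qed
  have nonneg: "peval q x \<ge> 0" if "q \<in> M" for q
    using pconst.infinitesimal_approx_nonneg[OF M(1,3) that x] .
  then have "peval f x > 0" using pos M(2) by blast
  then show False using nonneg[OF M(4)] by (simp add: peval_minus)
qed

section \<open>Truncated quadratic modules and their union\<close>

lemma is_sos_iff: "is_sos s \<longleftrightarrow> s \<in> sos"
proof
  assume "is_sos s"
  then obtain qs where "s = sum_list (map (\<lambda>q. q * q) qs)" by (auto simp: is_sos_def)
  moreover have "sum_list (map (\<lambda>q. q * q) qs) \<in> sos"
    by (induction qs) (auto intro: sos.intros)
  ultimately show "s \<in> sos" by simp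
next
  assume "s \<in> sos"
  then show "is_sos s"
  proof (induction rule: sos.induct)
    case zero
    show ?case unfolding is_sos_def by (intro exI[of _ "[]"]) simp
  next
    case (square s a)
    then obtain qs where "s = sum_list (map (\<lambda>q. q * q) qs)" by (auto simp: is_sos_def)
    then show ?case unfolding is_sos_def by (intro exI[of _ "a # qs"]) simp
  qed
qed

lemma peval_sos_nonneg: "s \<in> sos \<Longrightarrow> peval s v \<ge> 0"
  by (induction rule: sos.induct) (simp_all add: peval_zero peval_add peval_mult)

lemma peval_quad_module_nonneg:
  assumes "p \<in> quad_module k H" "\<And>h. h \<in> set H \<Longrightarrow> peval h v \<ge> 0"
  shows "peval p v \<ge> 0"
proof -
  obtain \<sigma> where \<sigma>: "\<And>j. j \<le> length H \<Longrightarrow> is_sos (\<sigma> j)"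
    "p = (\<Sum>j\<le>length H. \<sigma> j * (if j = 0 then 1 else H ! (j - 1)))"
    using assms(1) by (auto simp: quad_module_def)
  have "peval (\<sigma> j) v * peval (if j = 0 then 1 else H ! (j - 1)) v \<ge> 0" if "j \<le> length H" for j
    using that \<sigma>(1)[OF that] assms(2)[of "H ! (j - 1)"]
    by (intro mult_nonneg_nonneg) (auto simp: peval_one is_sos_iff intro: peval_sos_nonneg)
  then show ?thesis unfolding \<sigma>(2) peval_sum peval_mult by (intro sum_nonneg) simp
qed

lemma quad_module_mono: "k \<le> k' \<Longrightarrow> quad_module k H \<subseteq> quad_module k' H"
  unfolding quad_module_def by (intro Collect_mono ex_mono impI conj_mono) (auto intro: order_trans)

text \<open>The union of all \<open>quad_module k H\<close>. Without the degree bound it is closed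
  under multiplication by squares, as Putinar's theorem requires.\<close>

definition generated_module :: "'v mpoly list \<Rightarrow> 'v mpoly set" where
  "generated_module H = {\<Sum>j\<le>length H. \<sigma> j * (if j = 0 then 1 else H ! (j - 1)) |\<sigma>.
      \<forall>j\<le>length H. \<sigma> j \<in> sos}"

lemma generated_module_in_quad_module:
  assumes "p \<in> generated_module H"
  shows "\<exists>k. p \<in> quad_module k H"
proof -
  obtain \<sigma> where \<sigma>: "\<And>j. j \<le> length H \<Longrightarrow> \<sigma> j \<in> sos"
    "p = (\<Sum>j\<le>length H. \<sigma> j * (if j = 0 then 1 else H ! (j - 1)))"
    using assms by (auto simp: generated_module_def)
  define d where "d j = total_deg (\<sigma> j * (if j = 0 then 1 else H ! (j - 1)))" for j
  \<comment> \<open>A crude common bound: the sum dominates each single degree.\<close>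
  define k where "k = (\<Sum>j\<le>length H. d j)"
  have "d j \<le> 2 * k" if "j \<le> length H" for j
    using member_le_sum[of j "{..length H}" d] that by (simp add: k_def)
  then have "p \<in> quad_module k H"
    unfolding quad_module_def is_sos_iff d_def using \<sigma> by blast
  then show ?thesis ..
qed

lemma quadratic_module_generated_module: "quadratic_module (generated_module H)"
proof -
  let ?h = "\<lambda>j. if j = 0 then 1 else H ! (j - 1)"
  have "1 = (\<Sum>j\<le>length H. (if j = 0 then 1 else 0) * ?h j)"
    by (simp add: if_distrib[of "\<lambda>x. x * _"] cong: if_cong)
  then have one: "1 \<in> generated_module H"
    unfolding generated_module_def using sos_one sos.zero
    by (intro CollectI exI[of _ "\<lambda>j. if j = 0 then 1 else 0"]) auto
  have add: "p + q \<in> generated_module H" if pq: "p \<in> generated_module H" "q \<in> generated_module H" for p q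
  proof -
    obtain \<sigma> \<tau> where "\<forall>j\<le>length H. \<sigma> j \<in> sos" "\<forall>j\<le>length H. \<tau> j \<in> sos"
      "p = (\<Sum>j\<le>length H. \<sigma> j * ?h j)" "q = (\<Sum>j\<le>length H. \<tau> j * ?h j)"
      using pq unfolding generated_module_def by blast
    then show ?thesis
      unfolding generated_module_def
      by (intro CollectI exI[of _ "\<lambda>j. \<sigma> j + \<tau> j"])
        (simp add: sos_add distrib_right sum.distrib)
  qed
  have "a * a * p \<in> generated_module H" if p: "p \<in> generated_module H" for a p
  proof -
    obtain \<sigma> where "\<forall>j\<le>length H. \<sigma> j \<in> sos" "p = (\<Sum>j\<le>length H. \<sigma> j * ?h j)"
      using p unfolding generated_module_def by blast
    moreover from this have "a * a * p = (\<Sum>j\<le>length H. (a * a * \<sigma> j) * ?h j)"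
      by (simp add: sum_distrib_left mult.assoc)
    ultimately show ?thesis
      unfolding generated_module_def
      by (intro CollectI exI[of _ "\<lambda>j. a * a * \<sigma> j"] conjI allI impI sos_square_mult) simp_all
  qed
  with one add show ?thesis by (auto simp: quadratic_module_def)
qed

lemma generator_in_generated_module:
  assumes "h \<in> set H"
  shows "h \<in> generated_module H"
proof -
  obtain i where i: "i < length H" "h = H ! i" using assms by (auto simp: in_set_conv_nth)
  \<comment> \<open>The list entry at position \<open>i\<close> has index \<open>Suc i\<close>,
    since index 0 belongs to the constant generator 1.\<close>
  have "(\<Sum>j\<le>length H. (if j = Suc i then 1 else 0) * (if j = 0 then 1 else H ! (j - 1))) =
      (\<Sum>j\<le>length H. if j = Suc i then h else 0)"
    using i by (intro sum.cong) auto
  also have "\<dots> = h" using i by simp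
  finally show ?thesis
    unfolding generated_module_def using sos_one sos.zero
    by (intro CollectI exI[of _ "\<lambda>j. if j = Suc i then 1 else 0"]) auto
qed

text \<open>Adding the squares of the other variables to \<open>1 - norm_sq_poly\<close> leaves
  \<open>1 - pvar i * pvar i\<close>. The identity \<open>2 (1 - p) = (1 - p)^2 + (1 - p^2)\<close>,
  for \<open>p\<close> and \<open>- p\<close>, then turns the bound on the square into linear
  bounds.\<close>

lemma pvar_bounded_on_sphere:
  fixes Q :: "('n::finite) option mpoly set"
  assumes Q: "quadratic_module Q" and sphere: "1 - norm_sq_poly \<in> Q"
  shows "pvar i \<in> pconst.bounded_by_constants Q"
proof -
  note Q' = quadratic_moduleD[OF Q]
  have sq: "a * a \<in> Q" for a using Q'(3)[OF Q'(1), of a] by simp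
  have sum: "(\<Sum>j\<in>J. pvar j * pvar j) \<in> Q" for J :: "'n option set"
    by (induction J rule: infinite_finite_induct) (auto intro: Q' sq quadratic_module_zero[OF Q])
  have rem: "norm_sq_poly = pvar i * pvar i + (\<Sum>j\<in>UNIV - {i}. pvar j * pvar j)"
    unfolding norm_sq_poly_def by (rule sum.remove) auto
  have "(1 - norm_sq_poly) + (\<Sum>j\<in>UNIV - {i}. pvar j * pvar j) = 1 - pvar i * pvar i"
    by (subst rem) simp
  then have sq1: "1 - pvar i * pvar i \<in> Q"
    using Q'(2)[OF sphere sum[of "UNIV - {i}"]] by (simp only:)
  have two: "pconst 2 = 1 + 1" using pconst.c_add[of 1 1] by (simp add: pconst.c_one)
  have *: "1 - p \<in> Q" if "1 - p * p \<in> Q" for p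
  proof -
    have "(1 - p) * (1 - p) + (1 - p * p) = pconst 2 * (1 - p)"
      unfolding two by (simp add: algebra_simps)
    then have "pconst 2 * (1 - p) \<in> Q" using Q'(2)[OF sq[of "1 - p"] that] by (simp only:)
    then show ?thesis using pconst.c_descale_mem[OF Q, of 2] by simp
  qed
  have "1 - pvar i \<in> Q" "1 - (- pvar i) \<in> Q" using *[of "pvar i"] *[of "- pvar i"] sq1 by simp_all
  then show ?thesis
    unfolding pconst.bounded_by_constants_def by (intro CollectI exI[of _ 1]) (simp add: pconst.c_one)
qed

section \<open>Homogenization and linear forms\<close>

lemma peval_homogenize:
  "peval (homogenize g) y = (\<Sum>m\<in>Poly_Mapping.keys g. Poly_Mapping.lookup g m *
     (y None ^ (total_deg g - mono_deg m) * mono_eval m (\<lambda>i. y (Some i))))"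
  unfolding homogenize_def peval_sum peval_single hom_mono_def mono_eval_add
    mono_eval_sum[OF finite_keys] mono_eval_single ..

lemma peval_homogenize_dehomogenize:
  "y None = 1 \<Longrightarrow> peval (homogenize g) y = peval g (\<lambda>i. y (Some i))"
  unfolding peval_homogenize by (simp add: peval_def)

lemma mono_deg_le_total_deg: "m \<in> Poly_Mapping.keys g \<Longrightarrow> mono_deg m \<le> total_deg g"
  unfolding total_deg_def by (intro Max_ge) auto

lemma mono_eval_scale: "mono_eval m (\<lambda>i. t * v i) = t ^ mono_deg m * mono_eval m v"
  by (simp add: power_mult_distrib prod.distrib mono_deg_def power_sum)

lemma peval_homogenize_scale:
  "peval (homogenize g) (\<lambda>i. t * y i) = t ^ total_deg g * peval (homogenize g) y"
proof -
  have "(t * y None) ^ (total_deg g - mono_deg m) * mono_eval m (\<lambda>i. t * y (Some i)) =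
      t ^ total_deg g * (y None ^ (total_deg g - mono_deg m) * mono_eval m (\<lambda>i. y (Some i)))"
    if "m \<in> Poly_Mapping.keys g" for m
  proof -
    \<comment> \<open>The natural number subtraction is exact because no monomial of
      \<open>g\<close> exceeds the total degree.\<close>
    have "t ^ total_deg g = t ^ (total_deg g - mono_deg m) * t ^ mono_deg m"
      using mono_deg_le_total_deg[OF that] by (simp flip: power_add)
    then show ?thesis unfolding mono_eval_scale by (simp add: power_mult_distrib)
  qed
  then show ?thesis
    unfolding peval_homogenize sum_distrib_left
    by (intro sum.cong) (simp_all add: mult.left_commute)
qed

lemma mono_deg_1_single:
  assumes "mono_deg m = 1"
  shows "\<exists>i. m = Poly_Mapping.single i 1"
proof -
  have "(\<Sum>i\<in>Poly_Mapping.keys m. Poly_Mapping.lookup m i) = 1" using assms by (simp add: mono_deg_def)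
  then obtain i where i: "i \<in> Poly_Mapping.keys m" "Poly_Mapping.lookup m i = 1"
     "\<forall>j\<in>Poly_Mapping.keys m. i \<noteq> j \<longrightarrow> Poly_Mapping.lookup m j = 0"
    unfolding sum_eq_1_iff[OF finite_keys] by blast
  have "m = Poly_Mapping.single i 1"
    by (rule poly_mapping_eqI) (use i in \<open>auto simp: lookup_single when_def in_keys_iff\<close>)
  then show ?thesis ..
qed

text \<open>Identifies a linear form with its coefficient vector, so that its nonnegativity becomes
  a half-space condition.\<close>

lemma peval_linear_form:
  fixes l :: "('v::finite) mpoly"
  assumes "linear_form l"
  shows "peval l v = (\<Sum>i\<in>UNIV. Poly_Mapping.lookup l (Poly_Mapping.single i 1) * v i)"
proof -
  let ?s = "\<lambda>i::'v. Poly_Mapping.single i (1::nat)"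
  have inj: "inj ?s" by (rule injI) (metis lookup_single_eq lookup_single_not_eq one_neq_zero)
  have "Poly_Mapping.keys l \<subseteq> range ?s"
    using assms mono_deg_1_single unfolding linear_form_def by blast
  then have "peval l v = (\<Sum>m\<in>range ?s. Poly_Mapping.lookup l m * mono_eval m v)"
    by (intro peval_superset) auto
  also have "\<dots> = (\<Sum>i\<in>UNIV. Poly_Mapping.lookup l (?s i) * mono_eval (?s i) v)"
    by (rule sum.reindex[OF inj, unfolded o_def])
  finally show ?thesis by simp
qed

definition poly_of_vec :: "real ^ 'v \<Rightarrow> ('v::finite) mpoly" where
  "poly_of_vec a = (\<Sum>i\<in>UNIV. Poly_Mapping.single (Poly_Mapping.single i 1) (a $ i))"

lemma linear_form_poly_of_vec: "linear_form (poly_of_vec a)"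
proof -
  have "Poly_Mapping.keys (poly_of_vec a) \<subseteq> (\<Union>i. {Poly_Mapping.single i 1})"
    unfolding poly_of_vec_def by (rule order_trans[OF keys_sum]) auto
  then show ?thesis unfolding linear_form_def by (auto simp: mono_deg_def)
qed

lemma peval_poly_of_vec: "peval (poly_of_vec a) v = (\<Sum>i\<in>UNIV. a $ i * v i)"
  by (simp add: poly_of_vec_def peval_sum peval_single)

section \<open>The homogenized semialgebraic set\<close>

text \<open>The affine chart of homogeneous coordinates; \<open>proj_vec\<close> is central
  projection back to it, meaningful only where the coordinate \<open>None\<close> is
  nonzero.\<close>

definition lift_vec :: "real ^ 'n \<Rightarrow> real ^ ('n::finite) option" where
  "lift_vec x = (\<chi> i. case i of None \<Rightarrow> 1 | Some j \<Rightarrow> x $ j)"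

definition proj_vec :: "real ^ 'n option \<Rightarrow> real ^ ('n::finite)" where
  "proj_vec y = (\<chi> j. y $ Some j / y $ None)"

lemma lift_vec_nth [simp]: "lift_vec x $ None = 1" "lift_vec x $ Some j = x $ j"
  by (simp_all add: lift_vec_def)

lemma lift_vec_nonzero: "lift_vec x \<noteq> 0"
  by (metis lift_vec_nth(1) zero_index zero_neq_one)

lemma proj_lift_vec [simp]: "proj_vec (lift_vec x) = x"
  by (simp add: proj_vec_def vec_eq_iff)

lemma lift_proj_vec: "y $ None \<noteq> 0 \<Longrightarrow> lift_vec (proj_vec y) = (1 / y $ None) *\<^sub>R y"
  by (simp add: vec_eq_iff proj_vec_def lift_vec_def split: option.split)

lemma inner_lift_vec: "a \<bullet> lift_vec x = a $ None + (\<chi> j. a $ Some j) \<bullet> x"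
  by (simp add: inner_vec_def UNIV_option_conv sum.reindex)

lemma peval_homogenize_scaleR:
  "peval (homogenize g) (($) (t *\<^sub>R y)) = t ^ total_deg g * peval (homogenize g) (($) y)"
proof -
  have "($) (t *\<^sub>R y) = (\<lambda>i. t * y $ i)" by (simp add: fun_eq_iff)
  then show ?thesis by (simp add: peval_homogenize_scale)
qed

lemma scale_S_open_tilde:
  assumes "t > 0" "y \<in> S_open_tilde gs"
  shows "t *\<^sub>R y \<in> S_open_tilde gs"
  using assms by (simp add: S_open_tilde_def peval_homogenize_scaleR)

lemma scale_S_closed_tilde:
  assumes "t > 0" "y \<in> S_closed_tilde gs"
  shows "t *\<^sub>R y \<in> S_closed_tilde gs"
  using assms by (simp add: S_closed_tilde_def peval_homogenize_scaleR)

lemma lift_vec_S_open_tilde_iff: "lift_vec x \<in> S_open_tilde gs \<longleftrightarrow> x \<in> semialg gs"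
  by (simp add: S_open_tilde_def semialg_def peval_homogenize_dehomogenize)

lemma S_open_tilde_subset: "S_open_tilde gs \<subseteq> S_closed_tilde gs"
  by (auto simp: S_open_tilde_def S_closed_tilde_def)

lemma peval_norm_sq_poly: "peval norm_sq_poly v = (\<Sum>i\<in>UNIV. v i * v i)"
  by (simp add: norm_sq_poly_def peval_sum peval_mult peval_pvar)

text \<open>The last two generators are negatives of each other, so nonnegativity of both confines
  the point to the unit sphere.\<close>

lemma G_tilde_nonneg_iff:
  "(\<forall>h\<in>set (G_tilde gs). peval h v \<ge> 0) \<longleftrightarrow>
     (\<chi> i. v i) \<in> S_closed_tilde gs \<inter> sphere 0 1"
proof -
  have "(norm (\<chi> i. v i) = 1) \<longleftrightarrow> ((\<chi> i. v i) \<bullet> (\<chi> i. v i) = 1)"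
    by (simp add: norm_eq_1)
  then have "norm (\<chi> i. v i) = 1 \<longleftrightarrow> (\<Sum>i\<in>UNIV. v i * v i) = 1" by (simp add: inner_vec_def)
  moreover have "($) (\<chi> i. v i) = v" by (simp add: fun_eq_iff)
  ultimately show ?thesis
    by (auto simp: G_tilde_def S_closed_tilde_def peval_pvar peval_diff peval_one peval_norm_sq_poly)
qed

section \<open>Theta bodies as intersections of closed half-spaces\<close>

lemma modified_theta_halfspaces:
  fixes H :: "('n::finite) option mpoly list"
  shows "modified_theta k H = (\<Inter>l\<in>{l \<in> quad_module k H. linear_form l}.
     {x. (\<chi> i. Poly_Mapping.lookup l (Poly_Mapping.single i 1)) \<bullet> lift_vec x \<ge> 0})"
proof -
  have "peval l (\<lambda>i. case i of None \<Rightarrow> 1 | Some j \<Rightarrow> x $ j) =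
      (\<chi> i. Poly_Mapping.lookup l (Poly_Mapping.single i 1)) \<bullet> lift_vec x"
    if "linear_form l" for l :: "'n option mpoly" and x
    by (simp add: peval_linear_form[OF that] inner_vec_def lift_vec_def)
  then show ?thesis by (auto simp: modified_theta_def)
qed

lemma lifted_halfspace_eq:
  "{x. a \<bullet> lift_vec x \<ge> 0} = {x. (\<chi> j. a $ Some j) \<bullet> x \<ge> - a $ None}"
  by (auto simp: inner_lift_vec)

lemma closed_lifted_halfspace: "closed {x. a \<bullet> lift_vec x \<ge> 0}"
  unfolding lifted_halfspace_eq by (rule closed_halfspace_ge)

lemma convex_lifted_halfspace: "convex {x. a \<bullet> lift_vec x \<ge> 0}"
  unfolding lifted_halfspace_eq by (rule convex_halfspace_ge)

lemma closed_modified_theta: "closed (modified_theta k H)"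
  unfolding modified_theta_halfspaces by (intro closed_INT ballI closed_lifted_halfspace)

lemma convex_modified_theta: "convex (modified_theta k H)"
  unfolding modified_theta_halfspaces by (intro convex_INT convex_lifted_halfspace)

text \<open>The generators control signs only on the unit sphere, so \<open>lift_vec x\<close> is
  first normalized, which keeps it in the cone; a linear form has the same sign at both
  points.\<close>

lemma semialg_subset_modified_theta: "semialg gs \<subseteq> modified_theta k (G_tilde gs)"
proof
  fix x assume x: "x \<in> semialg gs"
  define t where "t = 1 / norm (lift_vec x)"
  have t: "t > 0" by (simp add: t_def lift_vec_nonzero)
  have "t *\<^sub>R lift_vec x \<in> S_closed_tilde gs"
    using x t scale_S_closed_tilde S_open_tilde_subset lift_vec_S_open_tilde_iff by blast
  moreover have "norm (t *\<^sub>R lift_vec x) = 1"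
    by (simp add: t_def lift_vec_nonzero)
  ultimately have G: "peval h (($) (t *\<^sub>R lift_vec x)) \<ge> 0" if "h \<in> set (G_tilde gs)" for h
    using G_tilde_nonneg_iff[of gs "($) (t *\<^sub>R lift_vec x)"] that
    by (simp only: vec_nth_inverse vec_lambda_eta) simp
  have "(\<chi> i. Poly_Mapping.lookup l (Poly_Mapping.single i 1)) \<bullet> lift_vec x \<ge> 0"
    if l: "l \<in> quad_module k (G_tilde gs)" "linear_form l" for l
  proof -
    have "peval l (($) (t *\<^sub>R lift_vec x)) \<ge> 0"
      by (rule peval_quad_module_nonneg[OF l(1) G])
    then have "t * ((\<chi> i. Poly_Mapping.lookup l (Poly_Mapping.single i 1)) \<bullet> lift_vec x) \<ge> 0"
      unfolding peval_linear_form[OF l(2)]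
      by (simp add: inner_vec_def sum_distrib_left mult.left_commute)
    then show ?thesis using t by (simp add: zero_le_mult_iff)
  qed
  then show "x \<in> modified_theta k (G_tilde gs)" by (simp add: modified_theta_halfspaces)
qed

text \<open>Since this holds for every \<open>k\<close>, the left inclusion of the theorem puts no
  constraint on the degree.\<close>

lemma closure_hull_subset_modified_theta:
  "closure (convex hull (semialg gs)) \<subseteq> modified_theta k (G_tilde gs)"
  by (intro closure_minimal hull_minimal semialg_subset_modified_theta closed_modified_theta
      convex_modified_theta)

section \<open>Separation of a point from the closed convex hull\<close>

lemma lift_vec_in_hull:
  assumes "lift_vec x \<in> convex hull (closure (S_open_tilde gs))"
  shows "x \<in> closure (convex hull (semialg gs))"
proof -
  \<comment> \<open>A convex set containing \<open>S_open_tilde gs\<close> whose points project into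
    the hull of \<open>semialg gs\<close>; its closure therefore contains the hull of the closed
    cone, and hence \<open>lift_vec x\<close>.\<close>
  define D where "D = {z. z $ None > 0 \<and> proj_vec z \<in> convex hull (semialg gs)}"
  have "proj_vec y \<in> semialg gs" if "y \<in> S_open_tilde gs" for y
  proof -
    have "y $ None > 0" using that by (simp add: S_open_tilde_def)
    then have "lift_vec (proj_vec y) \<in> S_open_tilde gs"
      using scale_S_open_tilde[OF _ that, of "1 / y $ None"] by (simp add: lift_proj_vec)
    then show ?thesis by (simp add: lift_vec_S_open_tilde_iff)
  qed
  then have sub: "S_open_tilde gs \<subseteq> D"
    by (auto simp: D_def S_open_tilde_def intro: hull_inc)
  have "convex D"
  proof (rule convexI)
    fix z w :: "real ^ 'a option" and u v :: real
    assume zw: "z \<in> D" "w \<in> D" and uv: "0 \<le> u" "0 \<le> v" "u + v = 1"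
    define s where "s = u * z $ None + v * w $ None"
    have zw0: "z $ None > 0" "w $ None > 0" using zw by (auto simp: D_def)
    have s: "s > 0"
      using zw0 uv unfolding s_def
      by (cases "u = 0") (auto intro: add_pos_nonneg)
    \<comment> \<open>Central projection preserves convex combinations after reweighting: each
      weight is multiplied by the point's coordinate \<open>None\<close> and divided by the total
      \<open>s\<close>.\<close>
    have "proj_vec (u *\<^sub>R z + v *\<^sub>R w) =
        (u * z $ None / s) *\<^sub>R proj_vec z + (v * w $ None / s) *\<^sub>R proj_vec w"
      using zw0 by (simp add: vec_eq_iff proj_vec_def s_def[symmetric] add_divide_distrib)
    also have "\<dots> \<in> convex hull (semialg gs)"
    proof (rule convexD[OF convex_convex_hull])
      show "u * z $ None / s + v * w $ None / s = 1"
        using s by (simp add: s_def flip: add_divide_distrib)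
    qed (use zw zw0 uv s in \<open>auto simp: D_def\<close>)
    finally show "u *\<^sub>R z + v *\<^sub>R w \<in> D" using s by (simp add: D_def s_def)
  qed
  then have "convex hull (S_open_tilde gs) \<subseteq> D" by (intro hull_minimal sub)
  moreover have "convex hull (closure (S_open_tilde gs)) \<subseteq> closure (convex hull (S_open_tilde gs))"
    by (intro hull_minimal closure_mono hull_subset convex_closure convex_convex_hull)
  ultimately have "lift_vec x \<in> closure D" using assms closure_mono by blast
  then obtain z where z: "\<And>n. z n \<in> D" "z \<longlonglongrightarrow> lift_vec x"
    by (auto simp: closure_sequential)
  \<comment> \<open>The limit has coordinate \<open>None\<close> equal to 1, so the division is
    continuous there.\<close>
  have "(\<lambda>n. proj_vec (z n)) \<longlonglongrightarrow> proj_vec (lift_vec x)"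
    unfolding proj_vec_def by (intro tendsto_vec_lambda tendsto_divide tendsto_vec_nth z(2)) simp
  then show ?thesis
    unfolding closure_sequential using z(1)
    by (intro exI[of _ "\<lambda>n. proj_vec (z n)"]) (auto simp: D_def)
qed

text \<open>One hyperplane gives both signs, by strictly separating 0 from the hull of
  \<open>- lift_vec x\<close> and the spherical section \<open>T\<close>. Compactness of that hull
  yields strictness; 0 in it would make \<open>lift_vec x\<close> a positive multiple of a point of
  the cone \<open>K\<close>.\<close>

lemma separating_positive_form:
  assumes A: "assumption_A gs" and x: "x \<notin> closure (convex hull (semialg gs))"
  obtains a where "a \<bullet> lift_vec x < 0" "\<And>y. y \<in> S_closed_tilde gs \<inter> sphere 0 1 \<Longrightarrow> a \<bullet> y > 0"
proof -
  define K where "K = convex hull (S_closed_tilde gs)"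
  define T where "T = S_closed_tilde gs \<inter> sphere 0 1"
  have cl: "closure (S_open_tilde gs) = S_closed_tilde gs" and pt: "pointed K"
    using A by (auto simp: assumption_A_def closed_at_infinity_def K_def)
  have xK: "lift_vec x \<notin> K" using lift_vec_in_hull x cl unfolding K_def by metis
  have scale: "t *\<^sub>R z \<in> K" if "t > 0" "z \<in> K" for t z
  proof -
    have "t *\<^sub>R z \<in> convex hull ((*\<^sub>R) t ` S_closed_tilde gs)"
      using that(2) unfolding K_def convex_hull_scaling by (rule imageI)
    also have "\<dots> \<subseteq> K" unfolding K_def using scale_S_closed_tilde that(1) by (intro hull_mono) auto
    finally show ?thesis .
  qed
  \<comment> \<open>This is where pointedness enters: a vanishing combination with positive weights
    would put a nonzero vector and its negative in \<open>K\<close>. It keeps 0 out of the hull of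
    \<open>T\<close>.\<close>
  have "convex (K - {0})"
  proof (rule convexI)
    fix y z and u v :: real
    assume yz: "y \<in> K - {0}" "z \<in> K - {0}" and uv: "0 \<le> u" "0 \<le> v" "u + v = 1"
    have "u *\<^sub>R y + v *\<^sub>R z \<noteq> 0"
    proof
      assume 0: "u *\<^sub>R y + v *\<^sub>R z = 0"
      then have "u \<noteq> 0" "v \<noteq> 0" using yz uv by auto
      then have "u *\<^sub>R y \<in> K" "v *\<^sub>R z \<in> K" using scale yz uv by auto
      moreover have "u *\<^sub>R y = - (v *\<^sub>R z)" using 0 by (simp add: eq_neg_iff_add_eq_0)
      ultimately have "u *\<^sub>R y \<in> K \<inter> uminus ` K" by blast
      then have "u *\<^sub>R y = 0" using pt unfolding pointed_def by blast
      then show False using yz \<open>u \<noteq> 0\<close> by simp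
    qed
    moreover have "u *\<^sub>R y + v *\<^sub>R z \<in> K"
      using yz uv unfolding K_def by (intro convexD[OF convex_convex_hull]) auto
    ultimately show "u *\<^sub>R y + v *\<^sub>R z \<in> K - {0}" by simp
  qed
  then have hullT: "convex hull T \<subseteq> K - {0}"
    by (intro hull_minimal) (auto simp: T_def K_def intro: hull_inc)
  have "compact T"
    unfolding T_def by (intro closed_Int_compact compact_sphere) (simp flip: cl)
  then have "compact (convex hull (insert (- lift_vec x) T))"
    by (intro compact_convex_hull compact_insert)
  moreover have "0 \<notin> convex hull (insert (- lift_vec x) T)"
  \<comment> \<open>The description of the hull of an inserted point requires a nonempty
    set.\<close>
  proof (cases "T = {}")
    case True
    then show ?thesis using lift_vec_nonzero[of x] by simp
  next
    case False
    show ?thesis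
    proof
      assume "0 \<in> convex hull (insert (- lift_vec x) T)"
      then obtain u v b where uv: "0 \<le> u" "0 \<le> v" "u + v = 1" and b: "b \<in> convex hull T"
        and 0: "0 = u *\<^sub>R (- lift_vec x) + v *\<^sub>R b"
        unfolding convex_hull_insert[OF False] by auto
      have bK: "b \<in> K" "b \<noteq> 0" using b hullT by auto
      have "u \<noteq> 0" using 0 uv bK by auto
      have eq: "u *\<^sub>R lift_vec x = v *\<^sub>R b" using 0 by simp
      then have "v \<noteq> 0" using \<open>u \<noteq> 0\<close> lift_vec_nonzero[of x] by auto
      have "lift_vec x = (1 / u) *\<^sub>R (u *\<^sub>R lift_vec x)" using \<open>u \<noteq> 0\<close> by simp
      also have "\<dots> = (v / u) *\<^sub>R b" unfolding eq by simp
      finally show False using xK scale[OF _ bK(1), of "v / u"] uv \<open>u \<noteq> 0\<close> \<open>v \<noteq> 0\<close> by simp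
    qed
  qed
  ultimately obtain a b where "0 < b"
    and ab: "\<And>z. z \<in> convex hull (insert (- lift_vec x) T) \<Longrightarrow> a \<bullet> z > b"
    using separating_hyperplane_closed_0[OF convex_convex_hull compact_imp_closed] by metis
  have "a \<bullet> z > 0" if "z \<in> insert (- lift_vec x) T" for z
    using ab[OF hull_inc[OF that]] \<open>0 < b\<close> by simp
  from this[of "- lift_vec x"] this show ?thesis
    by (intro that[of a]) (auto simp: T_def)
qed

text \<open>Strict positivity on the spherical section is the positivity hypothesis of Putinar's
  theorem, and the generator \<open>1 - norm_sq_poly\<close> supplies the archimedean bounds. The
  degree \<open>k\<close> obtained depends on \<open>x\<close>.\<close>

lemma separating_form_in_quad_module:
  assumes "assumption_A gs" "x \<notin> closure (convex hull (semialg gs))"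
  obtains k a where "a \<bullet> lift_vec x < 0" "poly_of_vec a \<in> quad_module k (G_tilde gs)"
proof -
  obtain a where a: "a \<bullet> lift_vec x < 0" "\<And>y. y \<in> S_closed_tilde gs \<inter> sphere 0 1 \<Longrightarrow> a \<bullet> y > 0"
    using separating_positive_form[OF assms] by metis
  have "poly_of_vec a \<in> generated_module (G_tilde gs)"
  proof (rule putinar_positivstellensatz)
    show "quadratic_module (generated_module (G_tilde gs))"
      by (rule quadratic_module_generated_module)
    then show "pvar i \<in> pconst.bounded_by_constants (generated_module (G_tilde gs))" for i
      by (rule pvar_bounded_on_sphere) (simp add: generator_in_generated_module G_tilde_def)
  next
    fix v assume "\<And>q. q \<in> generated_module (G_tilde gs) \<Longrightarrow> peval q v \<ge> 0"
    then have "(\<chi> i. v i) \<in> S_closed_tilde gs \<inter> sphere 0 1"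
      using G_tilde_nonneg_iff[of gs v] generator_in_generated_module by blast
    then have "a \<bullet> (\<chi> i. v i) > 0" by (rule a(2))
    then show "peval (poly_of_vec a) v > 0" by (simp add: peval_poly_of_vec inner_vec_def)
  qed
  then show ?thesis using generated_module_in_quad_module that a(1) by blast
qed

section \<open>A uniform degree by compactness\<close>

theorem mainTheorem9:
  fixes gs :: "('n::finite) mpoly list" and \<epsilon> r :: real
  assumes "assumption_A gs"
    and "\<epsilon> > 0" and "r > 0"
    and "closure (convex hull (semialg gs)) \<inter> cball 0 r \<noteq> {}"
  shows "\<exists>k::nat.
     closure (convex hull (semialg gs)) \<inter> cball 0 r \<subseteq> modified_theta k (G_tilde gs) \<inter> cball 0 r \<and>
     modified_theta k (G_tilde gs) \<inter> cball 0 r \<subseteq>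
       {a + b | a b. a \<in> closure (convex hull (semialg gs)) \<and> b \<in> cball 0 \<epsilon>} \<inter> cball 0 r"
proof -
  define C where "C = closure (convex hull (semialg gs))"
  \<comment> \<open>The points to be cut off. Removing open balls keeps the set compact, and any
    other point of the ball is within \<open>\<epsilon>\<close> of \<open>C\<close>.\<close>
  define D where "D = cball 0 r - (\<Union>c\<in>C. ball c \<epsilon>)"
  have "x \<notin> C" if "x \<in> D" for x using that \<open>\<epsilon> > 0\<close> by (auto simp: D_def)
  then have "\<exists>k a. a \<bullet> lift_vec x < 0 \<and> poly_of_vec a \<in> quad_module k (G_tilde gs)" if "x \<in> D" for x
    using separating_form_in_quad_module[OF assms(1)] that unfolding C_def by metis
  then obtain k a where ka: "\<And>x. x \<in> D \<Longrightarrow> a x \<bullet> lift_vec x < 0"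
    "\<And>x. x \<in> D \<Longrightarrow> poly_of_vec (a x) \<in> quad_module (k x) (G_tilde gs)" by metis
  have "compact D" unfolding D_def by (intro compact_diff compact_cball open_UN ballI open_ball)
  moreover have "open {z. a x \<bullet> lift_vec z < 0}" for x
    using closed_lifted_halfspace[of "a x"] by (simp add: closed_def Collect_neg_eq[symmetric] not_le)
  moreover have "D \<subseteq> (\<Union>x\<in>D. {z. a x \<bullet> lift_vec z < 0})" using ka(1) by auto
  ultimately obtain F where F: "F \<subseteq> D" "finite F" "D \<subseteq> (\<Union>x\<in>F. {z. a x \<bullet> lift_vec z < 0})"
    by (rule compactE_image)
  \<comment> \<open>The sum dominates every \<open>k x\<close> with \<open>x\<close> in the finite
    subcover, so all the chosen forms lie in the module of level \<open>N\<close>.\<close>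
  define N where "N = (\<Sum>x\<in>F. k x)"
  have "z \<notin> D" if z: "z \<in> modified_theta N (G_tilde gs)" for z
  proof
    assume "z \<in> D"
    then obtain x where x: "x \<in> F" "a x \<bullet> lift_vec z < 0" using F(3) by auto
    have "k x \<le> N" unfolding N_def using F(2) x(1) by (intro member_le_sum) auto
    then have "poly_of_vec (a x) \<in> quad_module N (G_tilde gs)"
      using ka(2) x(1) F(1) quad_module_mono by blast
    then have "peval (poly_of_vec (a x)) (\<lambda>i. case i of None \<Rightarrow> 1 | Some j \<Rightarrow> z $ j) \<ge> 0"
      using z linear_form_poly_of_vec unfolding modified_theta_def by blast
    then show False using x(2) by (simp add: peval_poly_of_vec inner_vec_def lift_vec_def)
  qed
  then have "\<exists>c\<in>C. z \<in> ball c \<epsilon>" if "z \<in> modified_theta N (G_tilde gs)" "z \<in> cball 0 r" for z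
    using that unfolding D_def by blast
  \<comment> \<open>The summand \<open>b\<close> is the difference \<open>z - c\<close>.\<close>
  then have "\<exists>c b. z = c + b \<and> c \<in> C \<and> b \<in> cball 0 \<epsilon>"
    if "z \<in> modified_theta N (G_tilde gs)" "z \<in> cball 0 r" for z
    using that by (metis add.commute diff_add_cancel dist_norm less_imp_le mem_ball mem_cball_0 norm_minus_commute)
  then have "modified_theta N (G_tilde gs) \<inter> cball 0 r \<subseteq> {c + b | c b. c \<in> C \<and> b \<in> cball 0 \<epsilon>} \<inter> cball 0 r"
    by blast
  then show ?thesis
    using closure_hull_subset_modified_theta[of gs N] unfolding C_def by blast
qed

end
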